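(* The eventual Helfgott delta is at most $1/2$.
   Context: For a subset $S$ of a group, $S^3=\{abc: a,b,c\in S\}$, and $S$ is symmetric if $S=\{s^{-1}:s\in S\}$. Let $\Delta$ be the set of positive real numbers $r$ for which there is an $N$ such that $|S^3|\ge|S|^{1+r}$ for every prime $p$ and every symmetric generating subset $S$ of $\mathrm{SL}(2,p)$ containing $1$ with $S^3\ne\mathrm{SL}(2,p)$ and $|S|\ge N$. The eventual Helfgott delta is defined to be the supremum of $\Delta$. *)

theory Defs
  imports
    "HOL-Analysis.Determinants"
    "HOL-Library.Extended_Real"
    "HOL-Algebra.Generated_Groups"
    "HOL-Number_Theory.Cong"
    "HOL-Computational_Algebra.Primes"
begin

definition mat_mod :: "int^2^2 \<Rightarrow> nat \<Rightarrow> int^2^2" where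
  "mat_mod A p = (\<chi> i j. A $ i $ j mod int p)"

text \<open>Elements of \<open>\<int>/p\<int>\<close> are represented by their residues in \<open>{0..<p}\<close>. A fixed carrier type is
  used for all \<open>p\<close> so that one can quantify over \<open>p\<close> inside a formula.\<close>

definition SL2 :: "nat \<Rightarrow> (int^2^2) monoid" where
  "SL2 p = \<lparr>carrier = {A. (\<forall>i j. A $ i $ j \<in> {0..<int p}) \<and> [det A = 1] (mod int p)},
            monoid.mult = (\<lambda>A B. mat_mod (A ** B) p),
            one = mat 1\<rparr>"

lemma mat_mod_mult_left: "mat_mod (mat_mod A p ** B) p = mat_mod (A ** B) p"
  by (auto simp: mat_mod_def matrix_matrix_mult_def vec_eq_iff sum_2
      intro!: mod_add_cong mod_mult_cong)

lemma mat_mod_mult_right: "mat_mod (A ** mat_mod B p) p = mat_mod (A ** B) p"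
  by (auto simp: mat_mod_def matrix_matrix_mult_def vec_eq_iff sum_2
      intro!: mod_add_cong mod_mult_cong)

lemma det_mat_mod: "[det (mat_mod A p) = det A] (mod int p)"
  by (auto simp: mat_mod_def det_2 cong_def intro!: mod_diff_cong mod_mult_cong)

lemma group_SL2:
  assumes "p > 1"
  shows "group (SL2 p)"
proof (rule groupI)
  fix A B assume A: "A \<in> carrier (SL2 p)" and B: "B \<in> carrier (SL2 p)"
  have "[det A * det B = 1 * 1] (mod int p)"
    using A B by (intro cong_mult) (auto simp: SL2_def)
  then have "[det (mat_mod (A ** B) p) = 1] (mod int p)"
    using det_mat_mod[of "A ** B" p] by (auto simp: det_mul intro: cong_trans)
  then show "A \<otimes>\<^bsub>SL2 p\<^esub> B \<in> carrier (SL2 p)"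
    using assms by (auto simp: SL2_def mat_mod_def)
next
  show "\<one>\<^bsub>SL2 p\<^esub> \<in> carrier (SL2 p)"
    using assms by (auto simp: SL2_def det_I) (auto simp: mat_def)
next
  fix A B C assume "A \<in> carrier (SL2 p)" "B \<in> carrier (SL2 p)" "C \<in> carrier (SL2 p)"
  show "A \<otimes>\<^bsub>SL2 p\<^esub> B \<otimes>\<^bsub>SL2 p\<^esub> C = A \<otimes>\<^bsub>SL2 p\<^esub> (B \<otimes>\<^bsub>SL2 p\<^esub> C)"
    by (simp add: SL2_def mat_mod_mult_left mat_mod_mult_right matrix_mul_assoc)
next
  fix A assume "A \<in> carrier (SL2 p)"
  then show "\<one>\<^bsub>SL2 p\<^esub> \<otimes>\<^bsub>SL2 p\<^esub> A = A"
    by (auto simp: SL2_def mat_mod_def vec_eq_iff)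
next
  fix A assume A: "A \<in> carrier (SL2 p)"
  define B :: "int^2^2" where
    "B = vector [vector [A$2$2, - A$1$2], vector [- A$2$1, A$1$1]]"
  have d: "[det A = 1] (mod int p)" using A by (simp add: SL2_def)
  have "det B = det A" by (simp add: B_def det_2)
  then have "[det (mat_mod B p) = 1] (mod int p)"
    using d det_mat_mod[of B p] by (auto intro: cong_trans)
  then have "mat_mod B p \<in> carrier (SL2 p)"
    using assms by (auto simp: SL2_def mat_mod_def)
  moreover have "mat_mod (B ** A) p = mat 1"
    using d assms
    by (simp add: mat_mod_def matrix_matrix_mult_def B_def mat_def vec_eq_iff forall_2 sum_2
        det_2 cong_def algebra_simps)
  ultimately show "\<exists>B\<in>carrier (SL2 p). B \<otimes>\<^bsub>SL2 p\<^esub> A = \<one>\<^bsub>SL2 p\<^esub>"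
    by (intro bexI[of _ "mat_mod B p"]) (auto simp: SL2_def mat_mod_mult_left)
qed

definition triple_prod :: "('a, 'b) monoid_scheme \<Rightarrow> 'a set \<Rightarrow> 'a set" where
  "triple_prod G S = {a \<otimes>\<^bsub>G\<^esub> b \<otimes>\<^bsub>G\<^esub> c | a b c. a \<in> S \<and> b \<in> S \<and> c \<in> S}"

definition symmetric_subset :: "('a, 'b) monoid_scheme \<Rightarrow> 'a set \<Rightarrow> bool" where
  "symmetric_subset G S \<longleftrightarrow> S = {inv\<^bsub>G\<^esub> s | s. s \<in> S}"

definition helfgott_exponents :: "real set" where
  "helfgott_exponents = {r. r > 0 \<and> (\<exists>N::nat. \<forall>p::nat. \<forall>S.
     prime p \<longrightarrow> S \<subseteq> carrier (SL2 p) \<longrightarrow> symmetric_subset (SL2 p) S \<longrightarrow>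
     generate (SL2 p) S = carrier (SL2 p) \<longrightarrow> \<one>\<^bsub>SL2 p\<^esub> \<in> S \<longrightarrow>
     triple_prod (SL2 p) S \<noteq> carrier (SL2 p) \<longrightarrow> card S \<ge> N \<longrightarrow>
     real (card (triple_prod (SL2 p) S)) \<ge> real (card S) powr (1 + r))}"

text \<open>The supremum is taken in the extended reals, since \<^const>\<open>Sup\<close> on type \<^typ>\<open>real\<close> is
  the supremum only for nonempty sets that are bounded above.\<close>

definition eventual_helfgott_delta :: ereal where
  "eventual_helfgott_delta = Sup (ereal ` helfgott_exponents)"

end

theory Submission
  imports Defs "HOL-Number_Theory.Residues"
begin

text \<open>
  The exponent \<open>1 / 2\<close> comes from the Borel subgroup: it has order about \<open>p\<^sup>2\<close>, whereas
  \<open>SL(2,p)\<close> has order about \<open>p\<^sup>3 = (p\<^sup>2)\<^bsup>1 + 1/2\<^esup>\<close>. So a generating set \<open>S\<close> that contains a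
  positive proportion of a Borel subgroup satisfies \<open>\<bar>S\<^sup>3\<bar> \<le> C \<bar>S\<bar>\<^bsup>3/2\<^esup>\<close> for trivial reasons, and
  the only difficulty is to keep \<open>S\<^sup>3\<close> away from the whole group. The full Borel subgroup together
  with a Weyl element \<open>w\<close> fails this, by the Bruhat decomposition.

  The remedy is to pass to a subgroup of index 2. Let \<open>p\<close> be an odd prime for which \<open>-1\<close> is a square,
  let \<open>H\<close> consist of the upper triangular matrices whose diagonal entries are squares, and let
  \<open>S = H \<union> {w, -w}\<close> (the set \<open>borel_weyl p\<close> below), where \<open>-w\<close> is the inverse of \<open>w\<close>. As \<open>H\<close>
  contains \<open>-1\<close>, the signs do not matter for double cosets of \<open>H\<close>. The lower left entries of
  \<open>H w H\<close> are, up to sign, products of diagonal entries of elements of \<open>H\<close>, hence squares; and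
  the only other products of three factors with a nonzero lower left entry are those in \<open>w H w\<close>,
  which are lower triangular. A matrix with nonsquare lower left entry and nonzero upper right entry is
  therefore missed (\<open>triple_prod_borel_weyl_neq\<close>). On the other hand \<open>H\<close> still contains all upper
  unipotents, and conjugating these by \<open>w\<close> gives the lower unipotents, so \<open>S\<close> generates
  (\<open>generate_borel_weyl\<close>).

  Since \<open>p\<^sup>2 \<le> 4 \<bar>S\<bar>\<close> and \<open>\<bar>S\<^sup>3\<bar> \<le> \<bar>SL(2,p)\<bar> \<le> p\<^sup>3\<close>, every admissible \<open>r\<close> satisfies
  \<open>\<bar>S\<bar>\<^bsup>1 + r\<^esup> \<le> 8 \<bar>S\<bar>\<^bsup>3/2\<^esup>\<close> for infinitely many \<open>p\<close>, and \<open>r \<le> 1 / 2\<close> follows as \<open>p\<close>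
  grows.
\<close>

section \<open>Two by two matrices over the prime field\<close>

text \<open>The entries are arbitrary integers, reduced only in the matrix itself, so that products and
  inverses are given by the polynomial formulas over the integers and equality of two such matrices
  becomes a system of four congruences.\<close>

definition M2 :: "nat \<Rightarrow> int \<Rightarrow> int \<Rightarrow> int \<Rightarrow> int \<Rightarrow> int^2^2" where
  "M2 p a b c d = mat_mod (vector [vector [a, b], vector [c, d]]) p"

lemma M2_entries [simp]:
  "M2 p a b c d $ 1 $ 1 = a mod int p" "M2 p a b c d $ 1 $ 2 = b mod int p"
  "M2 p a b c d $ 2 $ 1 = c mod int p" "M2 p a b c d $ 2 $ 2 = d mod int p"
  by (simp_all add: M2_def mat_mod_def)

lemma M2_eq_iff:
  "M2 p a b c d = M2 p a' b' c' d' \<longleftrightarrow>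
     [a = a'] (mod int p) \<and> [b = b'] (mod int p) \<and> [c = c'] (mod int p) \<and> [d = d'] (mod int p)"
  by (auto simp: vec_eq_iff forall_2 cong_def)

lemma M2_mult [simp]:
  "M2 p a b c d \<otimes>\<^bsub>SL2 p\<^esub> M2 p a' b' c' d' =
     M2 p (a * a' + b * c') (a * b' + b * d') (c * a' + d * c') (c * b' + d * d')"
  unfolding M2_def
  by (simp add: SL2_def mat_mod_mult_left mat_mod_mult_right)
     (simp add: mat_mod_def matrix_matrix_mult_def vec_eq_iff forall_2 sum_2)

lemma M2_in_carrier_iff:
  assumes "p > 1"
  shows "M2 p a b c d \<in> carrier (SL2 p) \<longleftrightarrow> [a * d - b * c = 1] (mod int p)"
proof -
  have "[det (M2 p a b c d) = a * d - b * c] (mod int p)"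
    using det_mat_mod[of "vector [vector [a, b], vector [c, d]]" p] by (simp add: M2_def det_2)
  then show ?thesis
    using assms by (auto simp: SL2_def forall_2 intro: cong_trans cong_sym)
qed

lemma SL2_cases:
  assumes "A \<in> carrier (SL2 p)"
  obtains a b c d where "A = M2 p a b c d" "[a * d - b * c = 1] (mod int p)"
proof
  show "A = M2 p (A$1$1) (A$1$2) (A$2$1) (A$2$2)"
    using assms by (auto simp: SL2_def vec_eq_iff forall_2)
  show "[A$1$1 * A$2$2 - A$1$2 * A$2$1 = 1] (mod int p)"
    using assms by (auto simp: SL2_def det_2)
qed

lemma one_SL2_eq:
  assumes "p > 1"
  shows "\<one>\<^bsub>SL2 p\<^esub> = M2 p 1 0 0 1"
  using assms by (simp add: SL2_def vec_eq_iff forall_2 mat_def)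

lemma inv_M2:
  assumes "p > 1" and det: "[a * d - b * c = 1] (mod int p)"
  shows "inv\<^bsub>SL2 p\<^esub> M2 p a b c d = M2 p d (- b) (- c) a"
proof -
  interpret group "SL2 p" by (rule group_SL2) fact
  have "M2 p a b c d \<in> carrier (SL2 p)" "M2 p d (- b) (- c) a \<in> carrier (SL2 p)"
    using assms by (simp_all add: M2_in_carrier_iff algebra_simps)
  moreover have "M2 p d (- b) (- c) a \<otimes>\<^bsub>SL2 p\<^esub> M2 p a b c d = \<one>\<^bsub>SL2 p\<^esub>"
    using det by (simp add: one_SL2_eq[OF \<open>p > 1\<close>] M2_eq_iff algebra_simps)
  ultimately show ?thesis by (blast intro: inv_equality)
qed


lemma coprime_of_not_cong_0:
  assumes "prime p" "\<not> [z = 0] (mod int p)"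
  shows "coprime z (int p)"
  using prime_imp_coprime[of "int p" z] assms by (simp add: cong_0_iff coprime_commute)

text \<open>The equation \<open>a d - b c = 1\<close> recovers the missing entry: if \<open>c \<noteq> 0\<close> it determines \<open>b\<close>, and
  if \<open>c = 0\<close> then \<open>a\<close> is a unit and it determines \<open>d\<close>.
  This gives the bound \<open>p\<^sup>3\<close> for the order of the group.\<close>

lemma inj_on_SL2_three_entries:
  assumes "prime p"
  shows "inj_on (\<lambda>A. (A$1$1, A$2$1, if A$2$1 = 0 then A$1$2 else A$2$2)) (carrier (SL2 p))"
proof (rule inj_onI)
  fix A B assume A: "A \<in> carrier (SL2 p)" and B: "B \<in> carrier (SL2 p)"
    and eq: "(A$1$1, A$2$1, if A$2$1 = 0 then A$1$2 else A$2$2) =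
             (B$1$1, B$2$1, if B$2$1 = 0 then B$1$2 else B$2$2)"
  have cancel: "x = y" if "x \<in> {0..<int p}" "y \<in> {0..<int p}" "\<not> [z = 0] (mod int p)"
    "[z * x = z * y] (mod int p)" for x y z
  proof -
    have "coprime z (int p)"
      using coprime_of_not_cong_0[OF assms that(3)] .
    then have "[x = y] (mod int p)" using that(4) by (simp add: cong_mult_lcancel)
    then show ?thesis using that(1,2) by (auto simp: cong_def)
  qed
  have range: "\<forall>i j. A$i$j \<in> {0..<int p}" "\<forall>i j. B$i$j \<in> {0..<int p}"
    and detA: "[A$1$1 * A$2$2 - A$1$2 * A$2$1 = 1] (mod int p)"
    and detB: "[A$1$1 * B$2$2 - B$1$2 * A$2$1 = 1] (mod int p)"
    using A B eq by (auto simp: SL2_def det_2)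
  show "A = B"
  proof (cases "A$2$1 = 0")
    case True
    have "\<not> [A$1$1 = 0] (mod int p)"
    proof
      assume "[A$1$1 = 0] (mod int p)"
      then have "[A$1$1 * A$2$2 = 0] (mod int p)"
        by (metis cong_scalar_right mult_zero_left)
      then have "[1 = 0] (mod int p)" using detA True by (auto intro: cong_trans cong_sym)
      then show False using prime_gt_1_nat[OF assms] by (simp add: cong_def)
    qed
    moreover have "[A$1$1 * A$2$2 = A$1$1 * B$2$2] (mod int p)"
      using detA detB True by (auto intro: cong_trans cong_sym)
    ultimately have "A$2$2 = B$2$2" using range by (intro cancel[of _ _ "A$1$1"]) auto
    then show ?thesis using eq True by (auto simp: vec_eq_iff forall_2)
  next
    case False
    then have "\<not> [A$2$1 = 0] (mod int p)" using range by (auto simp: cong_def)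
    moreover have "[A$2$1 * A$1$2 = A$2$1 * B$1$2] (mod int p)"
    proof -
      have *: "A$2$2 = B$2$2" using eq False by auto
      have "[A$1$1 * A$2$2 - A$1$2 * A$2$1 = A$1$1 * A$2$2 - B$1$2 * A$2$1] (mod int p)"
        using detA detB unfolding * by (auto intro: cong_trans cong_sym)
      then show ?thesis
        by (simp add: cong_iff_dvd_diff algebra_simps dvd_diff_commute)
    qed
    ultimately have "A$1$2 = B$1$2" using range by (intro cancel[of _ _ "A$2$1"]) auto
    then show ?thesis using eq False by (auto simp: vec_eq_iff forall_2)
  qed
qed

lemma
  assumes "prime p"
  shows finite_SL2: "finite (carrier (SL2 p))"
    and card_SL2_le: "card (carrier (SL2 p)) \<le> p ^ 3"
proof -
  let ?R = "{0..<int p}"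
  let ?f = "\<lambda>A::int^2^2. (A$1$1, A$2$1, if A$2$1 = 0 then A$1$2 else A$2$2)"
  have sub: "?f ` carrier (SL2 p) \<subseteq> ?R \<times> ?R \<times> ?R"
    by (auto simp: SL2_def)
  show "finite (carrier (SL2 p))"
    using inj_on_SL2_three_entries[OF assms] finite_subset[OF sub] by (auto dest: finite_imageD)
  have "card (carrier (SL2 p)) \<le> card (?R \<times> ?R \<times> ?R)"
    using inj_on_SL2_three_entries[OF assms] sub by (rule card_inj_on_le) simp
  then show "card (carrier (SL2 p)) \<le> p ^ 3"
    by (simp add: power3_eq_cube mult.assoc)
qed

section \<open>Squares modulo a prime\<close>

lemma QuadRes_mult: "QuadRes m a \<Longrightarrow> QuadRes m b \<Longrightarrow> QuadRes m (a * b)"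
  unfolding QuadRes_def by (metis cong_mult power_mult_distrib)

lemma QuadRes_cong: "[a = b] (mod m) \<Longrightarrow> QuadRes m a \<longleftrightarrow> QuadRes m b"
  unfolding QuadRes_def by (meson cong_trans cong_sym)

text \<open>An inverse \<open>d\<close> of \<open>a\<close> is congruent to \<open>a d\<^sup>2\<close>.\<close>

lemma QuadRes_inverse:
  assumes "[a * d = 1] (mod m)" "QuadRes m a"
  shows "QuadRes m d"
proof -
  from assms(2) obtain y where y: "[y^2 = a] (mod m)" by (auto simp: QuadRes_def)
  have "[(y * d)^2 = (a * d) * d] (mod m)"
    using cong_mult[OF y cong_refl[of "d^2"]] by (simp add: power2_eq_square ac_simps)
  also have "[(a * d) * d = 1 * d] (mod m)" using assms(1) by (rule cong_mult) simp
  finally show ?thesis by (auto simp: QuadRes_def)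
qed

text \<open>Squaring is not injective on the residues, since \<open>1\<close> and \<open>-1\<close> have the same square; on a
  finite set it is then not surjective.\<close>

lemma exists_nonresidue:
  assumes "p > 2"
  shows "\<exists>n. \<not> QuadRes (int p) n"
proof (rule ccontr)
  assume "\<not> ?thesis"
  then have all: "QuadRes (int p) n" for n by blast
  let ?f = "\<lambda>t. t^2 mod int p"
  have "{0..<int p} \<subseteq> ?f ` {0..<int p}"
  proof
    fix n assume n: "n \<in> {0..<int p}"
    from all[of n] obtain y where "[y^2 = n] (mod int p)" by (auto simp: QuadRes_def)
    then have "n = ?f (y mod int p)" using n by (simp add: cong_def power_mod)
    then show "n \<in> ?f ` {0..<int p}" using assms by auto
  qed
  then have "card {0..<int p} \<le> card (?f ` {0..<int p})" by (intro card_mono) simp_all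
  then have "inj_on ?f {0..<int p}"
    by (intro eq_card_imp_inj_on antisym card_image_le) simp_all
  moreover have "?f 1 = ?f (int p - 1)"
  proof -
    have "(int p - 1)^2 = 1 + int p * (int p - 2)" by (simp add: power2_eq_square algebra_simps)
    then show ?thesis by simp
  qed
  ultimately have "1 = int p - 1" by (rule inj_onD) (use assms in simp_all)
  then show False using assms by simp
qed

text \<open>A prime divisor of \<open>(n!)\<^sup>2 + 1\<close> exceeds \<open>n\<close>, and \<open>n!\<close> is a square root of \<open>-1\<close> modulo it.\<close>

lemma exists_prime_minus_one_square: "\<exists>p. prime p \<and> p > n \<and> QuadRes (int p) (-1)"
proof -
  have "(fact n)^2 + 1 \<noteq> (1::nat)" by simp
  then obtain p where p: "prime p" "p dvd (fact n)^2 + (1::nat)"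
    using prime_factor_nat by blast
  have "p > n"
  proof (rule ccontr)
    assume "\<not> p > n"
    then have "p dvd (fact n)^2"
      using p(1) by (simp add: prime_dvd_fact_iff dvd_power power2_eq_square)
    with p show False by (metis dvd_add_right_iff not_prime_unit)
  qed
  moreover have "int p dvd int ((fact n)^2 + 1)" using p(2) by (subst int_dvd_int_iff)
  then have "[(fact n)^2 = -1] (mod int p)"
    by (simp add: cong_iff_dvd_diff add.commute)
  then have "QuadRes (int p) (-1)" by (auto simp: QuadRes_def)
  ultimately show ?thesis using p(1) by blast
qed


section \<open>The square Borel subgroup with a Weyl element\<close>

definition square_borel :: "nat \<Rightarrow> (int^2^2) set" where
  "square_borel p = {M2 p a b 0 d | a b d. [a * d = 1] (mod int p) \<and> QuadRes (int p) a}"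

definition borel_weyl :: "nat \<Rightarrow> (int^2^2) set" where
  "borel_weyl p = square_borel p \<union> {M2 p 0 1 (- 1) 0, M2 p 0 (- 1) 1 0}"

text \<open>When \<open>-1\<close> is a square, the two Weyl elements can be treated alike, with a square parameter
  \<open>e\<close> standing for \<open>1\<close> or \<open>-1\<close>. This is the form in which products of elements are computed
  below.\<close>

lemma borel_weyl_cases:
  assumes "QuadRes (int p) (-1)" "A \<in> borel_weyl p"
  obtains a b d where "A = M2 p a b 0 d" "[a * d = 1] (mod int p)"
      "QuadRes (int p) a" "QuadRes (int p) d"
    | e where "A = M2 p 0 e (- e) 0" "e * e = 1" "QuadRes (int p) e"
proof -
  have "QuadRes (int p) 1" by (auto simp: QuadRes_def intro: exI[of _ 1])
  then show ?thesis
    using assms that(1) that(2)[of 1] that(2)[of "-1"]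
    by (auto simp: borel_weyl_def square_borel_def dest: QuadRes_inverse)
qed

lemma borel_weyl_subset:
  assumes "p > 1" shows "borel_weyl p \<subseteq> carrier (SL2 p)"
  using assms by (auto simp: borel_weyl_def square_borel_def M2_in_carrier_iff)

lemma one_in_borel_weyl:
  assumes "p > 1" shows "\<one>\<^bsub>SL2 p\<^esub> \<in> borel_weyl p"
  unfolding one_SL2_eq[OF assms] borel_weyl_def square_borel_def
  by (force simp: QuadRes_def intro: exI[of _ 1])

lemma inv_in_borel_weyl:
  assumes "p > 1" "A \<in> borel_weyl p"
  shows "inv\<^bsub>SL2 p\<^esub> A \<in> borel_weyl p"
proof -
  consider (borel) a b d where "A = M2 p a b 0 d" "[a * d = 1] (mod int p)" "QuadRes (int p) a"
    | (weyl) "A = M2 p 0 1 (- 1) 0" | (weyl') "A = M2 p 0 (- 1) 1 0"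
    using assms(2) by (auto simp: borel_weyl_def square_borel_def)
  then show ?thesis
  proof cases
    case borel
    have "inv\<^bsub>SL2 p\<^esub> A = M2 p d (- b) 0 a"
      using inv_M2[OF assms(1), of a d b 0] borel by simp
    moreover have "[d * a = 1] (mod int p)" using borel(2) by (simp add: mult.commute)
    ultimately show ?thesis
      using QuadRes_inverse[OF borel(2,3)] by (auto simp: borel_weyl_def square_borel_def)
  next
    case weyl
    then show ?thesis using inv_M2[OF assms(1), of 0 0 1 "-1"] by (simp add: borel_weyl_def)
  next
    case weyl'
    then show ?thesis using inv_M2[OF assms(1), of 0 0 "-1" 1] by (simp add: borel_weyl_def)
  qed
qed

lemma symmetric_borel_weyl:
  assumes "p > 1" shows "symmetric_subset (SL2 p) (borel_weyl p)"
proof -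
  interpret group "SL2 p" by (rule group_SL2) fact
  show ?thesis
    unfolding symmetric_subset_def
    using inv_in_borel_weyl[OF assms] borel_weyl_subset[OF assms]
    by (auto 0 3) (metis inv_inv subsetD)
qed

text \<open>Upper unipotents have the square \<open>1\<close> on the diagonal, so they belong to the set, and
  conjugation by the Weyl element turns them into the lower unipotents. A matrix with lower left
  entry \<open>c \<noteq> 0\<close> is a product of an upper, a lower and an upper unipotent, where the lower factor has
  entry \<open>c\<close>; a matrix with \<open>c = 0\<close> is brought to that form by one multiplication with a Weyl
  element.\<close>

lemma generate_borel_weyl:
  assumes "prime p"
  shows "generate (SL2 p) (borel_weyl p) = carrier (SL2 p)"
proof -
  have p: "p > 1" using assms by (rule prime_gt_1_nat)
  interpret group "SL2 p" by (rule group_SL2) fact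
  let ?G = "generate (SL2 p) (borel_weyl p)"
  have upper: "M2 p 1 x 0 1 \<in> ?G" for x
    by (rule generate.incl)
       (force simp: borel_weyl_def square_borel_def QuadRes_def intro: exI[of _ 1])
  have weyl: "M2 p 0 1 (- 1) 0 \<in> ?G" "M2 p 0 (- 1) 1 0 \<in> ?G"
    by (auto intro!: generate.incl simp: borel_weyl_def)
  have lower: "M2 p 1 0 x 1 \<in> ?G" for x
  proof -
    have "M2 p 0 1 (- 1) 0 \<otimes>\<^bsub>SL2 p\<^esub> M2 p 1 (- x) 0 1 \<otimes>\<^bsub>SL2 p\<^esub> M2 p 0 (- 1) 1 0 \<in> ?G"
      by (intro generate.eng upper weyl)
    then show ?thesis by simp
  qed
  have big_cell: "M2 p a b c d \<in> ?G"
    if det: "[a * d - b * c = 1] (mod int p)" and c: "\<not> [c = 0] (mod int p)" for a b c d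
  proof -
    have "coprime c (int p)"
      using coprime_of_not_cong_0[OF assms c] .
    then obtain i where i: "[c * i = 1] (mod int p)" using cong_solve_coprime_int by blast
    (* x and y are forced by the diagonal entries 1 + x c and c y + 1 of the product of the three
       unipotents; the determinant then makes the upper right entry come out as b. *)
    define x y where "x = (a - 1) * i" and "y = (d - 1) * i"
    have a: "[1 + x * c = a] (mod int p)" and d: "[c * y + 1 = d] (mod int p)"
      using cong_mult[OF cong_refl[of "a - 1"] i] cong_mult[OF cong_refl[of "d - 1"] i]
      by (simp_all add: x_def y_def cong_iff_dvd_diff algebra_simps)
    have b: "[(1 + x * c) * y + x = b] (mod int p)"
    proof -
      have "[c * ((1 + x * c) * y + x) = (1 + x * c) * (c * y + 1) - 1] (mod int p)"
        by (simp add: algebra_simps)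
      also have "[(1 + x * c) * (c * y + 1) - 1 = a * d - 1] (mod int p)"
        using a d by (intro cong_diff cong_mult cong_refl)
      also have "[a * d - 1 = c * b] (mod int p)"
        using det by (simp add: cong_iff_dvd_diff algebra_simps)
      finally show ?thesis using \<open>coprime c (int p)\<close> by (simp add: cong_mult_lcancel)
    qed
    have "M2 p 1 x 0 1 \<otimes>\<^bsub>SL2 p\<^esub> M2 p 1 0 c 1 \<otimes>\<^bsub>SL2 p\<^esub> M2 p 1 y 0 1 \<in> ?G"
      by (intro generate.eng upper lower)
    also have "M2 p 1 x 0 1 \<otimes>\<^bsub>SL2 p\<^esub> M2 p 1 0 c 1 \<otimes>\<^bsub>SL2 p\<^esub> M2 p 1 y 0 1 = M2 p a b c d"
      using a b d by (simp add: M2_eq_iff)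
    finally show ?thesis .
  qed
  have "A \<in> ?G" if A: "A \<in> carrier (SL2 p)" for A
  proof -
    obtain a b c d where A: "A = M2 p a b c d" and det: "[a * d - b * c = 1] (mod int p)"
      using SL2_cases[OF A] .
    show ?thesis
    proof (cases "[c = 0] (mod int p)")
      case False
      then show ?thesis using big_cell[OF det] A by simp
    next
      case True
      have "\<not> [d = 0] (mod int p)"
      proof
        assume "[d = 0] (mod int p)"
        then have "[a * d - b * c = a * 0 - b * 0] (mod int p)"
          using True by (intro cong_diff cong_mult cong_refl)
        with det have "[1 = 0] (mod int p)" by (auto intro: cong_trans cong_sym)
        then show False using p by (simp add: cong_def)
      qed
      then have "M2 p (- b) a (- d) c \<in> ?G"
        using det by (intro big_cell) (simp_all add: algebra_simps cong_0_iff)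
      then have "M2 p (- b) a (- d) c \<otimes>\<^bsub>SL2 p\<^esub> M2 p 0 (- 1) 1 0 \<in> ?G"
        by (intro generate.eng weyl)
      then show ?thesis by (simp add: A)
    qed
  qed
  then show ?thesis
    using generate_incl[OF borel_weyl_subset[OF p]] by blast
qed

text \<open>This is the obstruction that keeps the triple product set from being the whole group. With no
  Weyl factor, or with exactly two that are adjacent, the product is upper triangular; with exactly
  one, or with three, its lower left entry is a product of squares; with a Weyl factor at each end
  and a triangular matrix between, the upper right entry vanishes.\<close>

lemma triple_prod_borel_weyl_entries:
  assumes "QuadRes (int p) (-1)" "A \<in> triple_prod (SL2 p) (borel_weyl p)"
  obtains a b c d where "A = M2 p a b c d" "QuadRes (int p) c \<or> b = 0"
proof -
  have zero: "QuadRes (int p) 0" by (auto simp: QuadRes_def intro: exI[of _ 0])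
  have minus: "QuadRes (int p) (- x)" if "QuadRes (int p) x" for x
    using QuadRes_mult[OF assms(1) that] by simp
  obtain X Y Z where A: "A = X \<otimes>\<^bsub>SL2 p\<^esub> Y \<otimes>\<^bsub>SL2 p\<^esub> Z"
    and "X \<in> borel_weyl p" "Y \<in> borel_weyl p" "Z \<in> borel_weyl p"
    using assms(2) by (auto simp: triple_prod_def)
  (* Each factor is triangular or Weyl; multiplying out in the eight cases leaves only statements that
     a product of known squares, up to sign, is a square. *)
  then show ?thesis
    using that
    by (elim borel_weyl_cases[OF assms(1)]) (auto simp: intro!: zero minus QuadRes_mult)
qed

lemma triple_prod_borel_weyl_neq:
  assumes "p > 2" "QuadRes (int p) (-1)"
  shows "triple_prod (SL2 p) (borel_weyl p) \<noteq> carrier (SL2 p)"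
proof
  assume eq: "triple_prod (SL2 p) (borel_weyl p) = carrier (SL2 p)"
  (* The missed matrix has determinant 1, upper right entry 1 and nonsquare lower left entry n. *)
  obtain n where n: "\<not> QuadRes (int p) n" using exists_nonresidue[OF assms(1)] by blast
  have "M2 p 1 1 n (1 + n) \<in> carrier (SL2 p)"
    using assms(1) by (simp add: M2_in_carrier_iff)
  then obtain a b c d where "M2 p 1 1 n (1 + n) = M2 p a b c d" "QuadRes (int p) c \<or> b = 0"
    using triple_prod_borel_weyl_entries[OF assms(2)] unfolding eq by blast
  then have "QuadRes (int p) n \<or> [1 = 0] (mod int p)"
    by (auto simp: M2_eq_iff dest: QuadRes_cong)
  then show False using n assms(1) by (simp add: cong_def)
qed

text \<open>The residues \<open>1, \<dots>, (p - 1) / 2\<close> have pairwise distinct nonzero squares, so there are at least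
  \<open>(p - 1) / 2\<close> choices for the diagonal and \<open>p\<close> for the upper right entry. The factor 4 absorbs the
  difference between \<open>p (p - 1) / 2\<close> and \<open>p\<^sup>2\<close>.\<close>

lemma card_borel_weyl_ge:
  assumes "prime p" "p > 2"
  shows "p ^ 2 \<le> 4 * card (borel_weyl p)"
proof -
  define T where "T = {1..(int p - 1) div 2}"
  have inv: "\<exists>i. [t^2 * i = 1] (mod int p)" if "t \<in> T" for t
  proof -
    have "\<not> int p dvd t" using that assms(2) by (auto simp: T_def dest!: zdvd_imp_le)
    then have "coprime (t^2) (int p)"
      using coprime_of_not_cong_0[OF assms(1), of t] by (simp add: cong_0_iff)
    then show ?thesis using cong_solve_coprime_int by blast
  qed
  then obtain i where i: "[t^2 * i t = 1] (mod int p)" if "t \<in> T" for t by metis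
  let ?f = "\<lambda>(t, b). M2 p (t^2) b 0 (i t)"
  have "inj_on ?f (T \<times> {0..<int p})"
  proof (rule inj_onI, clarify)
    fix t b t' b' assume t: "t \<in> T" "t' \<in> T" and b: "b \<in> {0..<int p}" "b' \<in> {0..<int p}"
      and "M2 p (t^2) b 0 (i t) = M2 p (t'^2) b' 0 (i t')"
    then have *: "[t^2 = t'^2] (mod int p)" "[b = b'] (mod int p)" by (auto simp: M2_eq_iff)
    have "int p dvd (t - t') * (t + t')"
      using *(1) by (simp add: cong_iff_dvd_diff power2_eq_square algebra_simps)
    moreover have "\<not> int p dvd t + t'" using t by (auto simp: T_def dest!: zdvd_imp_le)
    ultimately have "int p dvd t - t'" using assms(1) by (auto simp: prime_dvd_mult_iff)
    then have "t = t'" 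
      using t dvd_imp_le_int[of "t - t'" "int p"] unfolding T_def by simp linarith
    with * b show "t = t' \<and> b = b'" by (auto simp: cong_def)
  qed
  moreover have "?f ` (T \<times> {0..<int p}) \<subseteq> borel_weyl p"
  proof clarify
    fix t b assume "t \<in> T"
    moreover have "QuadRes (int p) (t^2)" unfolding QuadRes_def using cong_refl by blast
    ultimately show "M2 p (t^2) b 0 (i t) \<in> borel_weyl p"
      using i by (auto simp: borel_weyl_def square_borel_def)
  qed
  moreover have "finite (borel_weyl p)"
    using finite_SL2[OF assms(1)] borel_weyl_subset finite_subset prime_gt_1_nat[OF assms(1)]
    by blast
  ultimately have "card (T \<times> {0..<int p}) \<le> card (borel_weyl p)" by (rule card_inj_on_le)
  moreover have "card (T \<times> {0..<int p}) = ((p - 1) div 2) * p"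
  proof -
    have "nat ((int p - 1) div 2) = (p - 1) div 2" using assms(2) by linarith
    then show ?thesis by (simp add: T_def)
  qed
  moreover have "p * p \<le> 4 * ((p - 1) div 2 * p)"
  proof -
    have "odd p" using assms by (simp add: prime_odd_nat)
    then have "p \<le> 4 * ((p - 1) div 2)" using assms(2) by presburger
    then show ?thesis unfolding mult.assoc[symmetric] by (rule mult_le_mono1)
  qed
  ultimately show ?thesis unfolding power2_eq_square by linarith
qed

theorem corollary5p3:
  shows "eventual_helfgott_delta \<le> ereal (1 / 2)"
proof -
  have "r \<le> 1 / 2" if "r \<in> helfgott_exponents" for r
  proof (rule ccontr)
    assume r: "\<not> r \<le> 1 / 2"
    from that obtain N where N: "real (card S) powr (1 + r) \<le> real (card (triple_prod (SL2 p) S))"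
      if "prime p" "S \<subseteq> carrier (SL2 p)" "symmetric_subset (SL2 p) S"
        "generate (SL2 p) S = carrier (SL2 p)" "\<one>\<^bsub>SL2 p\<^esub> \<in> S"
        "triple_prod (SL2 p) S \<noteq> carrier (SL2 p)" "N \<le> card S" for p S
      unfolding helfgott_exponents_def by blast
    (* K is chosen so that no q \<ge> K satisfies q powr (r - 1/2) \<le> 8, where 8 = 4 powr (3/2) is the
       constant coming from p^2 \<le> 4 q and p^3 = (p^2) powr (3/2). *)
    obtain K :: nat where K: "8 powr (1 / (r - 1 / 2)) < real K" using reals_Archimedean2 by blast
    obtain p where p: "prime p" "p > 4 * N + 4 * K + 4" "QuadRes (int p) (-1)"
      using exists_prime_minus_one_square by blast
    define q where "q = card (borel_weyl p)"
    have p2: "p > 2" using p by simp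
    have pq: "p ^ 2 \<le> 4 * q" unfolding q_def by (rule card_borel_weyl_ge[OF p(1) p2])
    have "p \<le> p ^ 2" by (simp add: power2_eq_square)
    with pq p(2) have q: "N \<le> q" "K \<le> q" "q > 0" by linarith+
    have p1: "p > 1" using p2 by simp
    have "triple_prod (SL2 p) (borel_weyl p) \<subseteq> carrier (SL2 p)"
    proof -
      interpret group "SL2 p" by (rule group_SL2) fact
      show ?thesis using borel_weyl_subset[OF p1] by (auto simp: triple_prod_def)
    qed
    then have "card (triple_prod (SL2 p) (borel_weyl p)) \<le> p ^ 3"
      using card_mono[OF finite_SL2[OF p(1)]] card_SL2_le[OF p(1)] le_trans by blast
    moreover have "real q powr (1 + r) \<le> real (card (triple_prod (SL2 p) (borel_weyl p)))"
      unfolding q_def using q p1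
      by (intro N p(1) borel_weyl_subset symmetric_borel_weyl generate_borel_weyl
          one_in_borel_weyl triple_prod_borel_weyl_neq p2 p(3)) (auto simp: q_def)
    ultimately have "real q powr (1 + r) \<le> real p ^ 3"
      by (metis of_nat_le_iff of_nat_power order_trans)
    also have "real p ^ 3 = (real p ^ 2) powr (3 / 2)"
    proof -
      have "(real p ^ 2) powr (3 / 2) = (real p powr 2) powr (3 / 2)" using p1 by simp
      also have "\<dots> = real p powr 3" unfolding powr_powr by simp
      also have "\<dots> = real p ^ 3" using p1 by simp
      finally show ?thesis by simp
    qed
    also have "\<dots> \<le> (4 * real q) powr (3 / 2)"
    proof (rule powr_mono2)
      show "real p ^ 2 \<le> 4 * real q"
        using pq by (metis of_nat_le_iff of_nat_mult of_nat_numeral of_nat_power)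
    qed simp_all
    also have "\<dots> = 8 * real q powr (3 / 2)"
    proof -
      have "(4::real) powr (3 / 2) = (2 powr 2) powr (3 / 2)" by simp
      also have "\<dots> = 8" unfolding powr_powr by simp
      finally show ?thesis by (simp add: powr_mult)
    qed
    finally have "real q powr (3 / 2) * real q powr (r - 1 / 2) \<le> real q powr (3 / 2) * 8"
      by (simp add: mult.commute flip: powr_add)
    then have "real q powr (r - 1 / 2) \<le> 8" using q(3) by simp
    moreover have "8 < real q powr (r - 1 / 2)"
    proof -
      have "8 = (8 powr (1 / (r - 1 / 2))) powr (r - 1 / 2)" using r by (simp add: powr_powr)
      also have "\<dots> < real q powr (r - 1 / 2)"
        using r K q(2) by (intro powr_less_mono2) auto
      finally show ?thesis .
    qed
    ultimately show False by simp
  qed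
  then show ?thesis
    unfolding eventual_helfgott_delta_def by (auto intro!: Sup_least)
qed

end
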